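(* Let $n\ge 1$ and let $f,g\in A^+(B_n)_1\cup A^+(B_n)_{n^2+1}$. With $\mathcal{R},\mathcal{L},\mathcal{D}$ denoting Green's relations on the additive semigroup $(A^+(B_n),+)$: (1) $f\,\mathcal{R}\,g$ if and only if $\mathrm{supp}(f)=\mathrm{supp}(g)$ and $(\alpha f)\pi_1=(\alpha g)\pi_1$ for all $\alpha\in\mathrm{supp}(f)$; (2) $f\,\mathcal{L}\,g$ if and only if $\mathrm{supp}(f)=\mathrm{supp}(g)$ and $(\alpha f)\pi_2=(\alpha g)\pi_2$ for all $\alpha\in\mathrm{supp}(f)$; (3) $f\,\mathcal{D}\,g$ if and only if $\mathrm{supp}(f)=\mathrm{supp}(g)$.
   Context: For $n\ge 1$ let $[n]=\{1,\dots,n\}$. The Brandt semigroup $(B_n,+)$ has underlying set $B_n=([n]\times[n])\cup\{\vartheta\}$ with $(i,j)+(k,l)=(i,l)$ if $j=k$, $(i,j)+(k,l)=\vartheta$ if $j\ne k$, and $\alpha+\vartheta=\vartheta+\alpha=\vartheta$ for all $\alpha\in B_n$. $M(B_n)$ is the set of all maps $B_n\to B_n$; arguments are written on the left of functions. It carries pointwise addition $\alpha(f+g)=\alpha f+\alpha g$ and composition $\alpha(f\circ g)=(\alpha f)g$. An affine map over $B_n$ is a map of the form $g+h$ with $g$ an endomorphism of the semigroup $(B_n,+)$ (not required to fix $\vartheta$) and $h\in M(B_n)$ a constant map. $A^+(B_n)$ (the affine near-semiring over $B_n$) is the smallest subset of $M(B_n)$ that contains all affine maps and is closed under $+$ and $\circ$.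 The support of $f\in M(B_n)$ is $\mathrm{supp}(f)=\{\alpha\in B_n : \alpha f\neq\vartheta\}$, and $A^+(B_n)_k$ is the set of $f\in A^+(B_n)$ with $|\mathrm{supp}(f)|=k$. The projections $\pi_1,\pi_2:[n]\times[n]\to[n]$ are $(p,q)\pi_1=p$ and $(p,q)\pi_2=q$. *)

theory Defs
  imports "HOL-Library.FuncSet"
begin

section \<open>The Brandt semigroup\<close>

text \<open>The selectors \<open>pi1\<close> and \<open>pi2\<close> are the two projections; their value at
  \<open>Theta\<close> is unspecified.\<close>

datatype brandt = Theta (\<open>\<vartheta>\<close>) | Elt (pi1: nat) (pi2: nat)

definition Brandt :: "nat \<Rightarrow> brandt set" where
  "Brandt n = insert \<vartheta> {Elt i j | i j. i \<in> {1..n} \<and> j \<in> {1..n}}"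

fun brandt_add :: "brandt \<Rightarrow> brandt \<Rightarrow> brandt" (infixl \<open>\<oplus>\<close> 65) where
  "Elt i j \<oplus> Elt k l = (if j = k then Elt i l else \<vartheta>)"
| "\<vartheta> \<oplus> _ = \<vartheta>"
| "_ \<oplus> \<vartheta> = \<vartheta>"

section \<open>Maps on the Brandt semigroup\<close>

text \<open>Maps are extensional (equal to \<open>undefined\<close> outside \<open>Brandt n\<close>), so that
  equality of HOL functions is equality of maps on \<open>Brandt n\<close>.\<close>

definition Maps :: "nat \<Rightarrow> (brandt \<Rightarrow> brandt) set" where
  "Maps n = Brandt n \<rightarrow>\<^sub>E Brandt n"

definition brandt_map_add ::
    "nat \<Rightarrow> (brandt \<Rightarrow> brandt) \<Rightarrow> (brandt \<Rightarrow> brandt) \<Rightarrow> brandt \<Rightarrow> brandt" where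
  "brandt_map_add n f g = (\<lambda>\<alpha>\<in>Brandt n. f \<alpha> \<oplus> g \<alpha>)"

text \<open>With arguments on the left, the product of \<open>f\<close> and \<open>g\<close> applies \<open>f\<close> first.\<close>

definition brandt_map_comp ::
    "nat \<Rightarrow> (brandt \<Rightarrow> brandt) \<Rightarrow> (brandt \<Rightarrow> brandt) \<Rightarrow> brandt \<Rightarrow> brandt" where
  "brandt_map_comp n f g = compose (Brandt n) g f"

definition Endos :: "nat \<Rightarrow> (brandt \<Rightarrow> brandt) set" where
  "Endos n = {g \<in> Maps n. \<forall>\<alpha>\<in>Brandt n. \<forall>\<beta>\<in>Brandt n. g (\<alpha> \<oplus> \<beta>) = g \<alpha> \<oplus> g \<beta>}"

definition Constants :: "nat \<Rightarrow> (brandt \<Rightarrow> brandt) set" where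
  "Constants n = {(\<lambda>\<alpha>\<in>Brandt n. c) | c. c \<in> Brandt n}"

definition Affine :: "nat \<Rightarrow> (brandt \<Rightarrow> brandt) set" where
  "Affine n = {brandt_map_add n g h | g h. g \<in> Endos n \<and> h \<in> Constants n}"

inductive_set A_plus :: "nat \<Rightarrow> (brandt \<Rightarrow> brandt) set" for n :: nat where
  affine: "f \<in> Affine n \<Longrightarrow> f \<in> A_plus n"
| add: "f \<in> A_plus n \<Longrightarrow> g \<in> A_plus n \<Longrightarrow> brandt_map_add n f g \<in> A_plus n"
| comp: "f \<in> A_plus n \<Longrightarrow> g \<in> A_plus n \<Longrightarrow> brandt_map_comp n f g \<in> A_plus n"

definition supp :: "nat \<Rightarrow> (brandt \<Rightarrow> brandt) \<Rightarrow> brandt set" where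
  "supp n f = {\<alpha> \<in> Brandt n. f \<alpha> \<noteq> \<vartheta>}"

definition A_plus_supp :: "nat \<Rightarrow> nat \<Rightarrow> (brandt \<Rightarrow> brandt) set" where
  "A_plus_supp n k = {f \<in> A_plus n. card (supp n f) = k}"

section \<open>Green's relations on a semigroup with carrier \<open>S\<close> and operation \<open>m\<close>\<close>

text \<open>The principal one-sided ideals \<open>aS\<^sup>1\<close> and \<open>S\<^sup>1a\<close>.\<close>

definition right_principal :: "'a set \<Rightarrow> ('a \<Rightarrow> 'a \<Rightarrow> 'a) \<Rightarrow> 'a \<Rightarrow> 'a set" where
  "right_principal S m a = insert a {m a s | s. s \<in> S}"

definition left_principal :: "'a set \<Rightarrow> ('a \<Rightarrow> 'a \<Rightarrow> 'a) \<Rightarrow> 'a \<Rightarrow> 'a set" where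
  "left_principal S m a = insert a {m s a | s. s \<in> S}"

definition green_R :: "'a set \<Rightarrow> ('a \<Rightarrow> 'a \<Rightarrow> 'a) \<Rightarrow> 'a rel" where
  "green_R S m = {(a, b) \<in> S \<times> S. right_principal S m a = right_principal S m b}"

definition green_L :: "'a set \<Rightarrow> ('a \<Rightarrow> 'a \<Rightarrow> 'a) \<Rightarrow> 'a rel" where
  "green_L S m = {(a, b) \<in> S \<times> S. left_principal S m a = left_principal S m b}"

definition green_D :: "'a set \<Rightarrow> ('a \<Rightarrow> 'a \<Rightarrow> 'a) \<Rightarrow> 'a rel" where
  "green_D S m = green_L S m O green_R S m"

end

theory Submission
  imports Defs
begin

text \<open>A map in \<open>A_plus n\<close> either fixes \<open>\<vartheta>\<close> or is constant, so a map of support size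
  \<open>1\<close> or \<open>n\<^sup>2 + 1\<close> takes a single value \<open>Elt i j\<close> on its support. Adding the constant map
  \<open>Elt j l\<close> on the right turns this value into \<open>Elt i l\<close>, and adding \<open>Elt k i\<close> on the left turns
  it into \<open>Elt k j\<close>, without changing the support. Conversely, adding any map on the right can only
  shrink the support and preserves the first coordinate where the sum is nonzero; dually on
  the left.\<close>

section \<open>Green's relations through mutual divisibility\<close>

text \<open>Reduces equality of ideals to finding one multiplier in each direction: if
  \<open>a = m b t\<close>, then every \<open>m a s\<close> equals \<open>m b (m t s)\<close>, and
  closure keeps \<open>m t s\<close> in \<open>S\<close>. Associativity is demanded on the whole
  type, which \<open>brandt_map_add\<close> satisfies because it restricts its result to
  \<open>Brandt n\<close>.\<close>

lemma green_R_iff: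
  assumes "\<And>x y. x \<in> S \<Longrightarrow> y \<in> S \<Longrightarrow> m x y \<in> S"
    and "\<And>x y z. m (m x y) z = m x (m y z)"
  shows "(a, b) \<in> green_R S m \<longleftrightarrow>
    a \<in> S \<and> b \<in> S \<and> a \<in> right_principal S m b \<and> b \<in> right_principal S m a"
proof -
  have "right_principal S m a \<subseteq> right_principal S m b"
    if "a \<in> right_principal S m b" for a b
    using that assms(1) unfolding right_principal_def by (auto simp: assms(2))
  moreover have "a \<in> right_principal S m a" for a
    by (simp add: right_principal_def)
  ultimately show ?thesis
    unfolding green_R_def by blast
qed

lemma green_L_iff:
  assumes "\<And>x y. x \<in> S \<Longrightarrow> y \<in> S \<Longrightarrow> m x y \<in> S"
    and "\<And>x y z. m (m x y) z = m x (m y z)"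
  shows "(a, b) \<in> green_L S m \<longleftrightarrow>
    a \<in> S \<and> b \<in> S \<and> a \<in> left_principal S m b \<and> b \<in> left_principal S m a"
proof -
  have "left_principal S m a \<subseteq> left_principal S m b"
    if "a \<in> left_principal S m b" for a b
    using that assms(1) unfolding left_principal_def by (auto simp flip: assms(2))
  moreover have "a \<in> left_principal S m a" for a
    by (simp add: left_principal_def)
  ultimately show ?thesis
    unfolding green_L_def by blast
qed

section \<open>Arithmetic and size of the Brandt semigroup\<close>

lemma brandt_add_Theta_right [simp]: "x \<oplus> \<vartheta> = \<vartheta>"
  by (cases x) auto

lemma brandt_add_assoc: "(x \<oplus> y) \<oplus> z = x \<oplus> (y \<oplus> z)"
  by (cases x; cases y; cases z) auto

lemma brandt_add_eq_Elt:
  "x \<oplus> y = Elt i l \<longleftrightarrow> (\<exists>j. x = Elt i j \<and> y = Elt j l)"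
  by (cases x; cases y) auto

lemma Elt_in_Brandt [simp]: "Elt i j \<in> Brandt n \<longleftrightarrow> i \<in> {1..n} \<and> j \<in> {1..n}"
  by (auto simp: Brandt_def)

lemma Theta_in_Brandt [simp]: "\<vartheta> \<in> Brandt n"
  by (simp add: Brandt_def)

lemma brandt_add_closed: "x \<in> Brandt n \<Longrightarrow> y \<in> Brandt n \<Longrightarrow> x \<oplus> y \<in> Brandt n"
  by (cases x; cases y) auto

lemma finite_Brandt: "finite (Brandt n)"
  and card_Brandt: "card (Brandt n) = n\<^sup>2 + 1"
proof -
  have eq: "Brandt n = insert \<vartheta> ((\<lambda>(i, j). Elt i j) ` ({1..n} \<times> {1..n}))"
    by (auto simp: Brandt_def)
  show "finite (Brandt n)"
    unfolding eq by simp
  have "inj_on (\<lambda>(i, j). Elt i j) ({1..n} \<times> {1..n})"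
    by (auto intro!: inj_onI)
  moreover have "\<vartheta> \<notin> (\<lambda>(i, j). Elt i j) ` ({1..n} \<times> {1..n})"
    by auto
  ultimately show "card (Brandt n) = n\<^sup>2 + 1"
    unfolding eq by (simp add: card_image power2_eq_square)
qed

section \<open>Maps in \<open>A_plus n\<close> and their value at \<open>\<vartheta>\<close>\<close>

lemma brandt_map_add_assoc:
  "brandt_map_add n (brandt_map_add n f g) h = brandt_map_add n f (brandt_map_add n g h)"
  by (auto simp: brandt_map_add_def brandt_add_assoc)

lemma A_plus_subset_Maps: "A_plus n \<subseteq> Maps n"
proof
  fix f assume "f \<in> A_plus n"
  then show "f \<in> Maps n"
  proof induction
    case (affine f)
    then show ?case
      by (auto simp: Affine_def Endos_def Constants_def Maps_def brandt_map_add_def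
          intro!: brandt_add_closed)
  next
    case (add f g)
    then show ?case
      by (auto simp: Maps_def brandt_map_add_def intro!: brandt_add_closed)
  next
    case (comp f g)
    then show ?case
      by (auto simp: Maps_def brandt_map_comp_def compose_def)
  qed
qed

text \<open>Since \<open>\<vartheta>\<close> is absorbing, so is its image among the values of
  \<open>g\<close>. If that image is \<open>Elt i j\<close>, absorption from the two sides
  determines both coordinates of every \<open>g \<alpha>\<close>, and idempotence gives
  \<open>i = j\<close>.\<close>

lemma Endos_fix_Theta_or_constant:
  assumes "g \<in> Endos n"
  shows "g \<vartheta> = \<vartheta> \<or> (\<exists>c. \<forall>\<alpha>\<in>Brandt n. g \<alpha> = c)"
proof (cases "g \<vartheta>")
  case (Elt i j)
  have hom: "g (\<alpha> \<oplus> \<beta>) = g \<alpha> \<oplus> g \<beta>" if "\<alpha> \<in> Brandt n" "\<beta> \<in> Brandt n" for \<alpha> \<beta>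
    using assms that by (auto simp: Endos_def)
  have "g \<alpha> = Elt i j" if "\<alpha> \<in> Brandt n" for \<alpha>
  proof -
    have "Elt i j \<oplus> Elt i j = Elt i j" "Elt i j \<oplus> g \<alpha> = Elt i j" "g \<alpha> \<oplus> Elt i j = Elt i j"
      using hom[of \<vartheta> \<vartheta>] hom[of \<vartheta> \<alpha>] hom[of \<alpha> \<vartheta>] that Elt by simp_all
    then show ?thesis
      by (auto simp: brandt_add_eq_Elt split: if_splits)
  qed
  then show ?thesis
    by blast
qed simp

text \<open>The dichotomy survives both operations: a sum fixes \<open>\<vartheta>\<close> as soon
  as one summand does, and a composite is constant as soon as one factor is.\<close>

lemma A_plus_fix_Theta_or_constant:
  "f \<in> A_plus n \<Longrightarrow> f \<vartheta> = \<vartheta> \<or> (\<exists>c. \<forall>\<alpha>\<in>Brandt n. f \<alpha> = c)"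
proof (induction rule: A_plus.induct)
  case (affine f)
  then obtain g c where g: "g \<in> Endos n" and f: "f = brandt_map_add n g (\<lambda>\<alpha>\<in>Brandt n. c)"
    by (auto simp: Affine_def Constants_def)
  show ?case
    using Endos_fix_Theta_or_constant[OF g] by (auto simp: f brandt_map_add_def)
next
  case (add f g)
  then show ?case
    by (auto simp: brandt_map_add_def)
next
  case (comp f g)
  \<comment> \<open>Constancy of \<open>g\<close> is known only on \<open>Brandt n\<close>, so the
    values of \<open>f\<close> must be located there.\<close>
  then have "f \<alpha> \<in> Brandt n" if "\<alpha> \<in> Brandt n" for \<alpha>
    using that A_plus_subset_Maps by (auto simp: Maps_def)
  then show ?case
    using comp.IH by (auto simp: brandt_map_comp_def compose_def)
qed

text \<open>Supplies the multipliers for Green's relations. The idempotent \<open>Elt i i\<close>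
  gives a constant endomorphism and is a left identity for \<open>Elt i j\<close>.\<close>

lemma constant_in_A_plus:
  assumes "i \<in> {1..n}" "j \<in> {1..n}"
  shows "(\<lambda>\<alpha>\<in>Brandt n. Elt i j) \<in> A_plus n"
proof (rule A_plus.affine)
  have "(\<lambda>\<alpha>\<in>Brandt n. Elt i i) \<in> Endos n"
    using assms by (auto simp: Endos_def Maps_def brandt_add_closed)
  moreover have "(\<lambda>\<alpha>\<in>Brandt n. Elt i j) \<in> Constants n"
    using assms by (auto simp: Constants_def)
  moreover have "(\<lambda>\<alpha>\<in>Brandt n. Elt i j) =
      brandt_map_add n (\<lambda>\<alpha>\<in>Brandt n. Elt i i) (\<lambda>\<alpha>\<in>Brandt n. Elt i j)"
    by (auto simp: brandt_map_add_def)
  ultimately show "(\<lambda>\<alpha>\<in>Brandt n. Elt i j) \<in> Affine n"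
    unfolding Affine_def by blast
qed

section \<open>Maps with a single nonzero value\<close>

text \<open>One form for singleton and full supports, so that later arguments need no split on the
  support size. Step maps are extensional, hence comparable with members of
  \<open>Maps n\<close>.\<close>

definition step_map :: "nat \<Rightarrow> brandt set \<Rightarrow> brandt \<Rightarrow> brandt \<Rightarrow> brandt" where
  "step_map n A c = (\<lambda>\<alpha>\<in>Brandt n. if \<alpha> \<in> A then c else \<vartheta>)"

lemma step_map_cases:
  assumes f: "f \<in> A_plus_supp n 1 \<union> A_plus_supp n (n\<^sup>2 + 1)"
  obtains i j where "i \<in> {1..n}" "j \<in> {1..n}" "f = step_map n (supp n f) (Elt i j)"
    "supp n f \<noteq> {}"
proof -
  have fA: "f \<in> A_plus n"
    using f by (auto simp: A_plus_supp_def)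
  then have fM: "f \<in> Maps n"
    using A_plus_subset_Maps by blast
  have ne: "supp n f \<noteq> {}"
    using f by (auto simp: A_plus_supp_def)
  have "\<exists>c. \<forall>\<alpha>\<in>supp n f. f \<alpha> = c"
  proof (cases "card (supp n f) = 1")
    case True
    then show ?thesis
      by (auto simp: card_1_singleton_iff)
  next
    case False
    then have "card (supp n f) = card (Brandt n)"
      using f by (auto simp: A_plus_supp_def card_Brandt)
    then have full: "supp n f = Brandt n"
      by (intro card_subset_eq) (auto simp: finite_Brandt supp_def)
    \<comment> \<open>Full support excludes the alternative that \<open>f\<close> fixes
      \<open>\<vartheta>\<close>.\<close>
    then have "\<vartheta> \<in> supp n f"
      by simp
    then have "f \<vartheta> \<noteq> \<vartheta>"
      by (simp add: supp_def)
    then show ?thesis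
      using A_plus_fix_Theta_or_constant[OF fA] by (simp add: full)
  qed
  then obtain c where c: "\<And>\<alpha>. \<alpha> \<in> supp n f \<Longrightarrow> f \<alpha> = c"
    by blast
  obtain \<alpha> where \<alpha>: "\<alpha> \<in> supp n f"
    using ne by blast
  then have "f \<alpha> \<noteq> \<vartheta>" "f \<alpha> \<in> Brandt n"
    using fM by (auto simp: supp_def Maps_def)
  then have "c \<noteq> \<vartheta>" "c \<in> Brandt n"
    by (simp_all add: c[OF \<alpha>])
  then obtain i j where "c = Elt i j" "i \<in> {1..n}" "j \<in> {1..n}"
    by (auto simp: Brandt_def)
  moreover have "f = step_map n (supp n f) c"
  proof
    fix \<alpha>
    show "f \<alpha> = step_map n (supp n f) c \<alpha>"
      using c[of \<alpha>] fM by (auto simp: step_map_def supp_def Maps_def)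
  qed
  ultimately show thesis
    using that ne by blast
qed

lemma step_map_add_right:
  "brandt_map_add n (step_map n A (Elt i j)) (\<lambda>\<alpha>\<in>Brandt n. Elt j l) = step_map n A (Elt i l)"
  by (auto simp: brandt_map_add_def step_map_def)

lemma step_map_add_left:
  "brandt_map_add n (\<lambda>\<alpha>\<in>Brandt n. Elt k i) (step_map n A (Elt i j)) = step_map n A (Elt k j)"
  by (auto simp: brandt_map_add_def step_map_def)

text \<open>The constants \<open>Elt j l\<close> and \<open>Elt l j\<close> lead from each map to
  the other. Only the first map is assumed to lie in \<open>A_plus n\<close>; the second then does
  too, being a sum.\<close>

lemma green_R_step_map:
  assumes "step_map n A (Elt i j) \<in> A_plus n" "j \<in> {1..n}" "l \<in> {1..n}"
  shows "(step_map n A (Elt i j), step_map n A (Elt i l)) \<in> green_R (A_plus n) (brandt_map_add n)"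
proof -
  let ?b = "step_map n A (Elt i l)"
  have "?b \<in> A_plus n"
    using A_plus.add[OF assms(1) constant_in_A_plus[OF assms(2,3)]]
    by (simp add: step_map_add_right)
  moreover have "step_map n A (Elt i j) \<in> right_principal (A_plus n) (brandt_map_add n) ?b"
    using step_map_add_right[of n A i l j] constant_in_A_plus[OF assms(3,2)]
    unfolding right_principal_def by force
  moreover have "?b \<in> right_principal (A_plus n) (brandt_map_add n) (step_map n A (Elt i j))"
    using step_map_add_right[of n A i j l] constant_in_A_plus[OF assms(2,3)]
    unfolding right_principal_def by force
  ultimately show ?thesis
    using assms(1) green_R_iff[OF A_plus.add brandt_map_add_assoc] by blast
qed

lemma green_L_step_map:
  assumes "step_map n A (Elt i j) \<in> A_plus n" "i \<in> {1..n}" "k \<in> {1..n}"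
  shows "(step_map n A (Elt i j), step_map n A (Elt k j)) \<in> green_L (A_plus n) (brandt_map_add n)"
proof -
  let ?b = "step_map n A (Elt k j)"
  have "?b \<in> A_plus n"
    using A_plus.add[OF constant_in_A_plus[OF assms(3,2)] assms(1)]
    by (simp add: step_map_add_left)
  moreover have "step_map n A (Elt i j) \<in> left_principal (A_plus n) (brandt_map_add n) ?b"
    using step_map_add_left[of n i k A j] constant_in_A_plus[OF assms(2,3)]
    unfolding left_principal_def by force
  moreover have "?b \<in> left_principal (A_plus n) (brandt_map_add n) (step_map n A (Elt i j))"
    using step_map_add_left[of n k i A j] constant_in_A_plus[OF assms(3,2)]
    unfolding left_principal_def by force
  ultimately show ?thesis
    using assms(1) green_L_iff[OF A_plus.add brandt_map_add_assoc] by blast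
qed

section \<open>Invariants of Green's relations\<close>

text \<open>The coordinates are compared on the support of \<open>f\<close> only: there both
  \<open>f \<alpha>\<close> and \<open>g \<alpha>\<close> differ from \<open>\<vartheta>\<close>,
  where \<open>pi1\<close> is unspecified.\<close>

lemma right_principal_supp_pi1:
  assumes "f \<in> right_principal S (brandt_map_add n) g"
  shows "supp n f \<subseteq> supp n g \<and> (\<forall>\<alpha>\<in>supp n f. pi1 (f \<alpha>) = pi1 (g \<alpha>))"
proof -
  have "y \<noteq> \<vartheta> \<and> pi1 (y \<oplus> z) = pi1 y" if "y \<oplus> z \<noteq> \<vartheta>" for y z
    using that by (cases y; cases z) (auto split: if_splits)
  then show ?thesis
    using assms by (auto simp: right_principal_def supp_def brandt_map_add_def)
qed

lemma left_principal_supp_pi2: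
  assumes "f \<in> left_principal S (brandt_map_add n) g"
  shows "supp n f \<subseteq> supp n g \<and> (\<forall>\<alpha>\<in>supp n f. pi2 (f \<alpha>) = pi2 (g \<alpha>))"
proof -
  have "z \<noteq> \<vartheta> \<and> pi2 (y \<oplus> z) = pi2 z" if "y \<oplus> z \<noteq> \<vartheta>" for y z
    using that by (cases y; cases z) (auto split: if_splits)
  then show ?thesis
    using assms by (auto simp: left_principal_def supp_def brandt_map_add_def)
qed

lemma green_R_imp_supp_pi1:
  assumes "(f, g) \<in> green_R (A_plus n) (brandt_map_add n)"
  shows "supp n f = supp n g \<and> (\<forall>\<alpha>\<in>supp n f. pi1 (f \<alpha>) = pi1 (g \<alpha>))"
  using assms right_principal_supp_pi1[of f "A_plus n" n g]
    right_principal_supp_pi1[of g "A_plus n" n f]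
  by (subst (asm) green_R_iff[OF A_plus.add brandt_map_add_assoc]) auto

lemma green_L_imp_supp_pi2:
  assumes "(f, g) \<in> green_L (A_plus n) (brandt_map_add n)"
  shows "supp n f = supp n g \<and> (\<forall>\<alpha>\<in>supp n f. pi2 (f \<alpha>) = pi2 (g \<alpha>))"
  using assms left_principal_supp_pi2[of f "A_plus n" n g]
    left_principal_supp_pi2[of g "A_plus n" n f]
  by (subst (asm) green_L_iff[OF A_plus.add brandt_map_add_assoc]) auto

theorem theorem3p6:
  fixes n :: nat and f g :: "brandt \<Rightarrow> brandt"
  assumes "n \<ge> 1"
    and "f \<in> A_plus_supp n 1 \<union> A_plus_supp n (n^2 + 1)"
    and "g \<in> A_plus_supp n 1 \<union> A_plus_supp n (n^2 + 1)"
  shows "((f, g) \<in> green_R (A_plus n) (brandt_map_add n) \<longleftrightarrow>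
            supp n f = supp n g \<and> (\<forall>\<alpha>\<in>supp n f. pi1 (f \<alpha>) = pi1 (g \<alpha>))) \<and>
         ((f, g) \<in> green_L (A_plus n) (brandt_map_add n) \<longleftrightarrow>
            supp n f = supp n g \<and> (\<forall>\<alpha>\<in>supp n f. pi2 (f \<alpha>) = pi2 (g \<alpha>))) \<and>
         ((f, g) \<in> green_D (A_plus n) (brandt_map_add n) \<longleftrightarrow> supp n f = supp n g)"
proof -
  obtain A i j where A: "supp n f = A" "A \<noteq> {}" and ij: "i \<in> {1..n}" "j \<in> {1..n}"
    and f: "f = step_map n A (Elt i j)"
    using step_map_cases[OF assms(2)] by metis
  obtain B k l where B: "supp n g = B" and kl: "k \<in> {1..n}" "l \<in> {1..n}"
    and g: "g = step_map n B (Elt k l)"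
    using step_map_cases[OF assms(3)] by metis
  have fA: "step_map n A (Elt i j) \<in> A_plus n"
    using f assms(2) by (auto simp: A_plus_supp_def)
  \<comment> \<open>Both maps are constant on their supports, so one point suffices to compare
    coordinates.\<close>
  obtain \<alpha> where \<alpha>: "\<alpha> \<in> A" "\<alpha> \<in> Brandt n"
    using A by (auto simp: supp_def)
  have R: "(f, g) \<in> green_R (A_plus n) (brandt_map_add n)"
    if eq: "supp n f = supp n g" and pi: "\<forall>\<alpha>\<in>supp n f. pi1 (f \<alpha>) = pi1 (g \<alpha>)"
  proof -
    have "B = A"
      using eq A B by simp
    moreover have "pi1 (f \<alpha>) = pi1 (g \<alpha>)"
      using pi \<alpha> A by blast
    then have "i = k"
      using \<alpha> \<open>B = A\<close> by (simp add: f g step_map_def)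
    ultimately show ?thesis
      using green_R_step_map[OF fA ij(2) kl(2)] by (simp add: f g)
  qed
  have L: "(f, g) \<in> green_L (A_plus n) (brandt_map_add n)"
    if eq: "supp n f = supp n g" and pi: "\<forall>\<alpha>\<in>supp n f. pi2 (f \<alpha>) = pi2 (g \<alpha>)"
  proof -
    have "B = A"
      using eq A B by simp
    moreover have "pi2 (f \<alpha>) = pi2 (g \<alpha>)"
      using pi \<alpha> A by blast
    then have "j = l"
      using \<alpha> \<open>B = A\<close> by (simp add: f g step_map_def)
    ultimately show ?thesis
      using green_L_step_map[OF fA ij(1) kl(1)] by (simp add: f g)
  qed
  have D: "(f, g) \<in> green_D (A_plus n) (brandt_map_add n)" if eq: "supp n f = supp n g"
  proof -
    \<comment> \<open>The intermediate map takes its first coordinate from \<open>g\<close> and its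
      second from \<open>f\<close>, making it L-related to \<open>f\<close> and R-related to
      \<open>g\<close>.\<close>
    let ?h = "step_map n A (Elt k j)"
    have "B = A"
      using eq A B by simp
    have fh: "(f, ?h) \<in> green_L (A_plus n) (brandt_map_add n)"
      using green_L_step_map[OF fA ij(1) kl(1)] by (simp add: f)
    then have "?h \<in> A_plus n"
      by (auto simp: green_L_def)
    then have "(?h, g) \<in> green_R (A_plus n) (brandt_map_add n)"
      using green_R_step_map ij(2) kl(2) \<open>B = A\<close> by (simp add: g)
    with fh show ?thesis
      unfolding green_D_def by blast
  qed
  \<comment> \<open>Each of the two factors of D preserves the support, hence so does their
    composite.\<close>
  have "supp n f = supp n g" if "(f, g) \<in> green_D (A_plus n) (brandt_map_add n)"
    using that green_R_imp_supp_pi1 green_L_imp_supp_pi2 unfolding green_D_def by blast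
  then show ?thesis
    using R L D green_R_imp_supp_pi1 green_L_imp_supp_pi2 by blast
qed

end
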